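(* For $j\in\{9,19,20,21,22,23\}$ let $T_j\in\mathbb{C}^5\otimes\mathbb{C}^5\otimes\mathbb{C}^5$ be the tensor represented by the $5\times5$ matrix of linear forms in $x_1,\dots,x_5$ which has $x_1$ in every diagonal entry, has the $2\times3$ matrix $N_j$ in rows $4,5$ and columns $1,2,3$, and is zero elsewhere, where $$N_9=\begin{pmatrix}x_2&x_3&0\\ x_4&x_5&0\end{pmatrix},\quad N_{19}=\begin{pmatrix}x_2&x_3&x_5\\ x_3&x_4&0\end{pmatrix},\quad N_{20}=\begin{pmatrix}x_2&x_4&x_5\\ x_3&0&0\end{pmatrix},$$ $$N_{21}=\begin{pmatrix}x_2&x_4&x_5\\ x_3&x_5&0\end{pmatrix},\quad N_{22}=\begin{pmatrix}x_2&x_4&0\\ x_3&0&x_5\end{pmatrix},\quad N_{23}=\begin{pmatrix}x_2&x_3&x_4\\ x_3&x_4&x_5\end{pmatrix}.$$ Then $\mathbf R(T_{21})=10$ and $\mathbf R(T_j)=9$ for $j\in\{9,19,20,22,23\}$.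
   Context: All vector spaces are over $\mathbb{C}$. A matrix of linear forms $\sum_i x_iM_i$ in independent variables $x_1,\dots,x_5$ represents the tensor $\sum_i a_i\otimes M_i\in\mathbb{C}^5\otimes(\mathbb{C}^5\otimes\mathbb{C}^5)$, with $\{a_i\}$ a basis of the first factor. $\mathbf R(T)$ is the tensor rank: the least $r$ such that $T$ is a sum of $r$ tensors of the form $u\otimes v\otimes w$. *)

theory Defs
  imports "HOL-Analysis.Analysis"
begin

definition tensor3 :: "complex^'a \<Rightarrow> complex^'b \<Rightarrow> complex^'c \<Rightarrow> complex^'c^'b^'a" where
  "tensor3 u v w = (\<chi> i j k. u $ i * v $ j * w $ k)"

definition tensor_rank :: "complex^'c^'b^'a \<Rightarrow> nat" where
  "tensor_rank T = (LEAST r. \<exists>u v w. T = (\<Sum>s<r. tensor3 (u s) (v s) (w s)))"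

text \<open>Every tensor is a finite sum of simple ones, so \<^const>\<open>tensor_rank\<close> is a genuine minimum.\<close>

lemma tensor_rank_decomposition_exists:
  fixes T :: "complex^'c::finite^'b::finite^'a::finite"
  shows "\<exists>(r::nat) u v w. T = (\<Sum>s<r. tensor3 (u s) (v s) (w s))"
proof -
  define I where "I = (UNIV :: ('a \<times> 'b \<times> 'c) set)"
  define t where "t p = (case p of (i, j, k) \<Rightarrow>
    tensor3 (axis i (T $ i $ j $ k)) (axis j 1) (axis k (1::complex)))" for p
  have T: "T = (\<Sum>p\<in>I. t p)"
    unfolding vec_eq_iff
  proof (intro allI)
    fix i j k
    have "(\<Sum>p\<in>I. t p) $ i $ j $ k
        = (\<Sum>p\<in>I. if p = (i, j, k) then T $ i $ j $ k else 0)"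
      unfolding sum_component
      by (rule sum.cong) (auto simp: t_def tensor3_def axis_def split: prod.splits)
    also have "\<dots> = T $ i $ j $ k" by (simp add: I_def)
    finally show "T $ i $ j $ k = (\<Sum>p\<in>I. t p) $ i $ j $ k" by simp
  qed
  have "finite I" by (simp add: I_def)
  then obtain f where f: "bij_betw f {..<card I} I"
    by (metis ex_bij_betw_nat_finite lessThan_atLeast0)
  have "T = (\<Sum>s<card I. t (f s))"
    using T sum.reindex_bij_betw[OF f, of t] by simp
  also have "\<dots> = (\<Sum>s<card I. tensor3
      (case f s of (i, j, k) \<Rightarrow> axis i (T $ i $ j $ k))
      (case f s of (i, j, k) \<Rightarrow> axis j 1) (case f s of (i, j, k) \<Rightarrow> axis k 1))"
    by (rule sum.cong) (auto simp: t_def split: prod.splits)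
  finally show ?thesis by - (intro exI, assumption)
qed

text \<open>The identification of a matrix with an element of the tensor product of the last two
  factors: the simple tensor of a vector and a matrix.\<close>

definition tensor_vec_mat :: "complex^'a \<Rightarrow> complex^'c^'b \<Rightarrow> complex^'c^'b^'a" where
  "tensor_vec_mat u M = (\<chi> i j k. u $ i * M $ j $ k)"

text \<open>A matrix of linear forms is given as the function sending the values of the variables
  to the resulting matrix. The matrix of coefficients of the \<open>i\<close>-th variable is then
  the value at the \<open>i\<close>-th standard unit vector.\<close>

definition tensor_of_forms ::
    "('a \<Rightarrow> complex^'a) \<Rightarrow> (complex^'a \<Rightarrow> complex^'c^'b) \<Rightarrow> complex^'c^'b^'a" where
  "tensor_of_forms a M = (\<Sum>i\<in>UNIV. tensor_vec_mat (a i) (M (axis i 1)))"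

lemma tensor_of_forms_eq:
  fixes M :: "complex^'a::finite \<Rightarrow> complex^'c::finite^'b::finite"
  assumes "\<And>x j k. M x $ j $ k = (\<Sum>i\<in>UNIV. x $ i * C i $ j $ k)"
  shows "tensor_of_forms a M = (\<Sum>i\<in>UNIV. tensor_vec_mat (a i) (C i))"
proof -
  have "M (axis i 1) = C i" for i
    by (simp add: vec_eq_iff assms axis_def if_distrib [of "\<lambda>z. z * _"] cong: if_cong)
  then show ?thesis by (simp add: tensor_of_forms_def)
qed

definition is_basis :: "('n \<Rightarrow> complex^'n) \<Rightarrow> bool" where
  "is_basis a \<longleftrightarrow> inj a \<and> vec.independent (range a) \<and> vec.span (range a) = UNIV"

text \<open>The elements of the index type \<open>5\<close> are \<open>1, 2, 3, 4, 5\<close>, with arithmetic modulo 5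
  (so \<open>5 = 0\<close>), and \<^const>\<open>vector\<close> fills in the entries starting at index 1;
  similarly for the types \<open>2\<close> and \<open>3\<close>. Other indices \<open>j\<close> are not used.\<close>

definition block_N :: "nat \<Rightarrow> complex^5 \<Rightarrow> complex^3^2" where
  "block_N j x =
    (if j = 9 then
       vector [vector [x$2, x$3, 0],
               vector [x$4, x$5, 0]]
     else if j = 19 then
       vector [vector [x$2, x$3, x$5],
               vector [x$3, x$4, 0]]
     else if j = 20 then
       vector [vector [x$2, x$4, x$5],
               vector [x$3, 0, 0]]
     else if j = 21 then
       vector [vector [x$2, x$4, x$5],
               vector [x$3, x$5, 0]]
     else if j = 22 then
       vector [vector [x$2, x$4, 0],
               vector [x$3, 0, x$5]]
     else if j = 23 then
       vector [vector [x$2, x$3, x$4],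
               vector [x$3, x$4, x$5]]
     else 0)"

definition form_matrix :: "nat \<Rightarrow> complex^5 \<Rightarrow> complex^5^5" where
  "form_matrix j x = vector
    [vector [x$1, 0, 0, 0, 0],
     vector [0, x$1, 0, 0, 0],
     vector [0, 0, x$1, 0, 0],
     vector [block_N j x $ 1 $ 1, block_N j x $ 1 $ 2, block_N j x $ 1 $ 3, x$1, 0],
     vector [block_N j x $ 2 $ 1, block_N j x $ 2 $ 2, block_N j x $ 2 $ 3, 0, x$1]]"

lemma vector_5:
  "(vector [p, q, r, s, t] :: 'a::zero^5) $ 1 = p"
  "(vector [p, q, r, s, t] :: 'a::zero^5) $ 2 = q"
  "(vector [p, q, r, s, t] :: 'a::zero^5) $ 3 = r"
  "(vector [p, q, r, s, t] :: 'a::zero^5) $ 4 = s"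
  "(vector [p, q, r, s, t] :: 'a::zero^5) $ 5 = t"
  by (simp_all add: vector_def)

definition tensor_T :: "(5 \<Rightarrow> complex^5) \<Rightarrow> nat \<Rightarrow> complex^5^5^5" where
  "tensor_T a j = tensor_of_forms a (form_matrix j)"

end

theory Submission
  imports Defs
begin

text \<open>Upper bounds: the identity block costs five simple tensors, and the \<open>2 \<times> 3\<close> block costs four
  if its space of matrices is spanned by matrices of rank one; for \<open>N\<^sub>2\<^sub>1\<close> it is not, and costs five.

  Lower bounds: write \<open>M x = (\<Sum>s<r. c\<^sub>s(x) v\<^sub>s w\<^sub>s\<^sup>T)\<close>. Four of the forms \<open>c\<^sub>s\<close> are
  coordinates on the hyperplane \<open>x\<^sub>1 = 0\<close>, and they vanish together at some \<open>x\<^sub>0\<close> with first coordinate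
  \<open>1\<close>. Since \<open>M x\<^sub>0\<close> is invertible, the remaining \<open>r - 4\<close> vectors \<open>v\<^sub>s\<close> span, so \<open>r \<ge> 9\<close>.
  If \<open>r = 9\<close>, these five \<open>v\<^sub>s\<close> form a basis, and each vector \<open>d\<close> of the basis dual to the four forms
  makes \<open>M d\<close> (which squares to zero) a rank-one perturbation of a diagonalizable matrix. A
  square-zero matrix with two Jordan blocks of size two is never of this kind, so \<open>M d\<close> has rank at most
  one; but for \<open>T\<^sub>2\<^sub>1\<close> some \<open>d\<close> has \<open>x\<^sub>5 \<noteq> 0\<close>, and then \<open>M d\<close> has rank two.\<close>

section \<open>Bilinear pairing and dual vectors\<close>

text \<open>No conjugation: a vector of coefficients stands for a linear form, so forms and points
  share one type.\<close>

definition dot :: "complex^'n \<Rightarrow> complex^'n \<Rightarrow> complex" where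
  "dot u x = (\<Sum>i\<in>UNIV. u $ i * x $ i)"

lemma dot_simps:
  "dot (u + v) x = dot u x + dot v x" "dot (u - v) x = dot u x - dot v x" "dot (k *s u) x = k * dot u x"
  "dot u (x + y) = dot u x + dot u y" "dot u (x - y) = dot u x - dot u y"
  "dot u (k *s x) = k * dot u x" "dot u 0 = 0" "dot 0 x = 0"
  by (simp_all add: dot_def algebra_simps sum.distrib sum_subtractf sum_distrib_left)

lemma dot_sum_right: "dot u (\<Sum>s\<in>A. f s) = (\<Sum>s\<in>A. dot u (f s))"
  by (induction A rule: infinite_finite_induct) (simp_all add: dot_simps)

lemma dot_axis: "dot (axis i 1) x = x $ i" "dot u (axis i 1) = u $ i"
  by (simp_all add: dot_def axis_def if_distrib [of "\<lambda>z. z * _"] if_distrib [of "\<lambda>z. _ * z"]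
      cong: if_cong)

lemma dot_eq_0_span:
  assumes "b \<in> vec.span B" "\<And>b. b \<in> B \<Longrightarrow> dot b x = 0"
  shows "dot b x = 0"
  using assms by (induction rule: vec.span_induct_alt) (simp_all add: dot_simps)

text \<open>The indicator of \<open>b\<close> on \<open>B\<close> extends to a linear map. It is
  taken into \<open>complex^1\<close> so that it has a matrix, whose only row is the dual
  vector.\<close>

lemma dual_vector:
  fixes B :: "(complex^'n) set"
  assumes "vec.independent B" "b \<in> B"
  obtains x where "dot b x = 1" "\<And>b'. b' \<in> B \<Longrightarrow> b' \<noteq> b \<Longrightarrow> dot b' x = 0"
proof -
  obtain g :: "complex^'n \<Rightarrow> complex^1" where g: "Vector_Spaces.linear (*s) (*s) g"
    and gB: "\<forall>x\<in>B. g x = (if x = b then 1 else 0)"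
    using vec.linear_independent_extend [OF assms(1), of "\<lambda>x. if x = b then 1 else 0"] by blast
  have "dot u (matrix g $ 1) = g u $ 1" for u
  proof -
    have "dot u (matrix g $ 1) = (matrix g *v u) $ 1"
      by (simp add: dot_def matrix_vector_mult_def mult.commute)
    then show ?thesis by (simp only: matrix_works [OF g])
  qed
  with gB assms(2) show ?thesis by (intro that [of "matrix g $ 1"]) auto
qed

text \<open>If some \<open>y\<close> lay outside the span, a vector dual to \<open>y\<close> and
  annihilated by \<open>X\<close> would contradict separation.\<close>

lemma span_eq_UNIV_if_separating:
  fixes X :: "(complex^'n) set"
  assumes sep: "\<And>x. (\<And>b. b \<in> X \<Longrightarrow> dot b x = 0) \<Longrightarrow> x = 0"
  shows "vec.span X = UNIV"
proof (rule ccontr)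
  assume "vec.span X \<noteq> UNIV"
  then obtain y where y: "y \<notin> vec.span X" by blast
  obtain B where B: "B \<subseteq> X" "vec.independent B" "X \<subseteq> vec.span B"
    by (rule vec.maximal_independent_subset)
  have spB: "vec.span B = vec.span X"
    using B vec.span_eq vec.span_superset by blast
  then have ind: "vec.independent (insert y B)"
    using y B(2) by (simp add: vec.independent_insert)
  have "y \<notin> B" using y spB vec.span_superset by blast
  obtain x where x: "dot y x = 1" "\<And>b. b \<in> insert y B \<Longrightarrow> b \<noteq> y \<Longrightarrow> dot b x = 0"
    using dual_vector [OF ind insertI1] by blast
  have "dot b x = 0" if "b \<in> X" for b
    using that B(3) x(2) \<open>y \<notin> B\<close> by (blast intro: dot_eq_0_span)
  then have "x = 0" by (rule sep)
  with x(1) show False by (simp add: dot_simps)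
qed

text \<open>The forms \<open>e\<close> and \<open>c s\<close> together separate points, so they
  span, and \<open>{e}\<close> extends to a basis chosen among them. The vectors \<open>x0\<close>
  and \<open>d s\<close> form the dual basis.\<close>

lemma hyperplane_coordinates:
  fixes e :: "complex^'n" and c :: "nat \<Rightarrow> complex^'n"
  assumes e: "e \<noteq> 0"
    and sep: "\<And>x. dot e x = 0 \<Longrightarrow> (\<And>s. s < r \<Longrightarrow> dot (c s) x = 0) \<Longrightarrow> x = 0"
  obtains S x0 d where "S \<subseteq> {..<r}" "card S = CARD('n) - 1"
    "dot e x0 = 1" "\<And>s. s \<in> S \<Longrightarrow> dot (c s) x0 = 0"
    "\<And>s. s \<in> S \<Longrightarrow> dot e (d s) = 0"
    "\<And>s t. s \<in> S \<Longrightarrow> t \<in> S \<Longrightarrow> dot (c t) (d s) = (if t = s then 1 else 0)"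
    "\<And>x. dot e x = 0 \<Longrightarrow> x = (\<Sum>s\<in>S. dot (c s) x *s d s)"
proof -
  let ?X = "insert e (c ` {..<r})"
  have "vec.independent {e}" using e by (simp add: vec.dependent_single)
  then obtain B where B: "{e} \<subseteq> B" "B \<subseteq> ?X" "vec.independent B" "?X \<subseteq> vec.span B"
    by (metis vec.maximal_independent_subset_extend empty_subsetI insert_subset insertI1)
  have "vec.span ?X = UNIV"
    by (rule span_eq_UNIV_if_separating) (auto intro: sep)
  then have spB: "vec.span B = UNIV"
    using B(4) vec.span_minimal [OF B(4) vec.subspace_span] by auto
  have finB: "finite B" using B(2) finite_subset by blast
  have "card B = CARD('n)"
    using vec.basis_card_eq_dim [of B UNIV] B(3) spB by (simp only: vec_dim_card) simp
  have "B - {e} \<subseteq> c ` {..<r}" using B(2) by blast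
  \<comment> \<open>The family \<open>c\<close> may repeat values; exactly one index is kept for
    each basis element other than \<open>e\<close>.\<close>
  then obtain S where S: "S \<subseteq> {..<r}" "inj_on c S" "B - {e} = c ` S"
    by (meson subset_image_inj)
  have finS: "finite S" using S(1) finite_subset by blast
  have eS: "c s \<noteq> e" "c s \<in> B" if "s \<in> S" for s using S(3) that by blast+
  have cS: "card S = CARD('n) - 1"
    using card_image [OF S(2)] \<open>card B = _\<close> B(1) finB unfolding S(3) [symmetric] by simp
  have eB: "e \<in> B" using B(1) by blast
  obtain x0 where x0: "dot e x0 = 1" "\<And>b. b \<in> B \<Longrightarrow> b \<noteq> e \<Longrightarrow> dot b x0 = 0"
    using dual_vector [OF B(3) eB] by blast
  have "\<forall>s\<in>S. \<exists>x. dot (c s) x = 1 \<and> (\<forall>b\<in>B. b \<noteq> c s \<longrightarrow> dot b x = 0)"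
    using dual_vector [OF B(3)] eS(2) by metis
  then obtain d where d: "\<And>s. s \<in> S \<Longrightarrow> dot (c s) (d s) = 1"
    "\<And>s b. s \<in> S \<Longrightarrow> b \<in> B \<Longrightarrow> b \<noteq> c s \<Longrightarrow> dot b (d s) = 0"
    by metis
  have de: "dot e (d s) = 0" if "s \<in> S" for s
    using d(2) [OF that eB] eS(1) [OF that] by metis
  have dc: "dot (c t) (d s) = (if t = s then 1 else 0)" if "s \<in> S" "t \<in> S" for s t
    by (metis d eS(2) S(2) inj_onD that)
  show ?thesis
  proof (rule that [OF S(1) cS x0(1) _ de dc])
    show "dot (c s) x0 = 0" if "s \<in> S" for s
      using x0(2) eS that by blast
    fix x assume x: "dot e x = 0"
    \<comment> \<open>Every element of the basis \<open>B\<close> vanishes at \<open>?z\<close>,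
      hence so does every form, in particular each coordinate.\<close>
    let ?z = "x - (\<Sum>s\<in>S. dot (c s) x *s d s)"
    have "dot b ?z = 0" if bB: "b \<in> B" for b
    proof (cases "b = e")
      case True
      then show ?thesis using x de by (simp add: dot_simps dot_sum_right)
    next
      case False
      then obtain t where t: "t \<in> S" "b = c t" using bB S(3) False by blast
      have "(\<Sum>s\<in>S. dot (c s) x * dot (c t) (d s)) = (\<Sum>s\<in>S. if s = t then dot (c s) x else 0)"
        using t by (intro sum.cong) (auto simp: dc)
      also have "\<dots> = dot (c t) x" using finS t by simp
      finally show ?thesis using t by (simp add: dot_simps dot_sum_right)
    qed
    then have "dot b ?z = 0" for b
      using spB by (intro dot_eq_0_span [of b B]) auto
    then have "?z $ i = 0" for i by (metis dot_axis(1))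
    then have "?z = 0" by (simp add: vec_eq_iff)
    then show "x = (\<Sum>s\<in>S. dot (c s) x *s d s)" by simp
  qed
qed

section \<open>The substitution method\<close>

text \<open>Choosing \<open>x0\<close> kills the summands indexed by \<open>S\<close>, so the range
  of \<open>M x0\<close>, which is everything, lies in the span of the other
  \<open>v s\<close>.\<close>

lemma substitution_method:
  fixes M :: "complex^'n \<Rightarrow> complex^'k^'m" and c :: "nat \<Rightarrow> complex^'n"
  assumes M: "\<And>x y. M x *v y = (\<Sum>s<r. (dot (c s) x * dot (w s) y) *s v s)"
    and e: "e \<noteq> 0"
    and inj: "\<And>x. dot e x = 0 \<Longrightarrow> M x = 0 \<Longrightarrow> x = 0"
    and surj: "\<And>x. dot e x = 1 \<Longrightarrow> surj ((*v) (M x))"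
  obtains S x0 d where "S \<subseteq> {..<r}" "card S = CARD('n) - 1"
    "dot e x0 = 1" "\<And>s. s \<in> S \<Longrightarrow> dot (c s) x0 = 0"
    "\<And>s. s \<in> S \<Longrightarrow> dot e (d s) = 0"
    "\<And>s t. s \<in> S \<Longrightarrow> t \<in> S \<Longrightarrow> dot (c t) (d s) = (if t = s then 1 else 0)"
    "\<And>x. dot e x = 0 \<Longrightarrow> x = (\<Sum>s\<in>S. dot (c s) x *s d s)"
    "vec.span (v ` ({..<r} - S)) = UNIV"
proof -
  \<comment> \<open>If all \<open>c s\<close> vanish at \<open>x\<close>, the decomposition gives
    \<open>M x = 0\<close>.\<close>
  have sep: "x = 0" if "dot e x = 0" "\<And>s. s < r \<Longrightarrow> dot (c s) x = 0" for x
  proof (rule inj [OF that(1)])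
    have "M x *v y = 0 *v y" for y using that(2) by (simp add: M)
    then show "M x = 0" using matrix_eq by blast
  qed
  obtain S x0 d where S: "S \<subseteq> {..<r}" "card S = CARD('n) - 1"
    "dot e x0 = 1" "\<And>s. s \<in> S \<Longrightarrow> dot (c s) x0 = 0"
    "\<And>s. s \<in> S \<Longrightarrow> dot e (d s) = 0"
    "\<And>s t. s \<in> S \<Longrightarrow> t \<in> S \<Longrightarrow> dot (c t) (d s) = (if t = s then 1 else 0)"
    "\<And>x. dot e x = 0 \<Longrightarrow> x = (\<Sum>s\<in>S. dot (c s) x *s d s)"
    using hyperplane_coordinates [of e r c, OF e sep] by blast
  have "M x0 *v y \<in> vec.span (v ` ({..<r} - S))" for y
  proof -
    have "M x0 *v y = (\<Sum>s\<in>{..<r} - S. (dot (c s) x0 * dot (w s) y) *s v s)"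
      unfolding M by (rule sum.mono_neutral_right) (auto simp: S(4))
    then show ?thesis
      by (simp only:) (intro vec.span_sum vec.span_scale vec.span_base imageI)
  qed
  then have "vec.span (v ` ({..<r} - S)) = UNIV"
    using surj [OF S(3)] by (metis UNIV_eq_I surjD)
  with S show ?thesis using that [of S x0 d] by blast
qed

section \<open>Spanning families and decompositions of minimal length\<close>

lemma UNIV_spanned_card_le:
  fixes v :: "nat \<Rightarrow> complex^'m"
  assumes "vec.span (v ` A) = UNIV" "finite A"
  shows "CARD('m) \<le> card A"
proof -
  have "CARD('m) \<le> card (v ` A)"
    using vec.dim_le_card [of UNIV "v ` A"] assms by (simp only: vec_dim_card) simp
  then show ?thesis using card_image_le [OF assms(2), of v] by linarith
qed

text \<open>A family is indexed, so repetitions must be excluded first: spanning forces the image to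
  have full cardinality, which makes \<open>v\<close> injective on \<open>A\<close> and its image a
  basis.\<close>

lemma spanning_family_independent:
  fixes v :: "nat \<Rightarrow> complex^'m"
  assumes sp: "vec.span (v ` A) = UNIV" and A: "finite A" "card A = CARD('m)"
    and z: "(\<Sum>s\<in>A. f s *s v s) = 0" and s: "s \<in> A"
  shows "f s = 0"
proof -
  have "CARD('m) \<le> card (v ` A)"
    using vec.dim_le_card [of UNIV "v ` A"] A sp by (simp only: vec_dim_card) simp
  then have "inj_on v A" using A card_image_le [OF A(1), of v] by (intro eq_card_imp_inj_on) auto
  have "vec.independent (v ` A)"
    by (rule vec.card_le_dim_spanning [of _ UNIV])
      (use sp A card_image_le [OF A(1), of v] in \<open>simp_all only: vec_dim_card, simp_all\<close>)
  then have *: "\<And>u. (\<Sum>x\<in>v ` A. u x *s x) = 0 \<Longrightarrow> \<forall>x\<in>v ` A. u x = 0"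
    using A(1) by (simp add: vec.independent_explicit)
  have "(\<Sum>x\<in>v ` A. f (inv_into A v x) *s x) = 0"
    using z \<open>inj_on v A\<close> by (simp add: sum.reindex)
  from * [OF this] show ?thesis using s \<open>inj_on v A\<close> by simp
qed

text \<open>If \<open>P\<close> is invertible then \<open>N P\<^sup>-\<^sup>1\<close>, up to the term with \<open>v0\<close>, is diagonal in the basis \<open>v\<close>;
  the proof uses that the square of a diagonal matrix has the same kernel, phrased without \<open>P\<^sup>-\<^sup>1\<close>.\<close>

lemma minimal_decomposition_kernel:
  fixes v w :: "nat \<Rightarrow> complex^'m" and P N :: "complex^'m^'m"
  assumes sp: "vec.span (v ` A) = UNIV" and A: "finite A" "card A = CARD('m)"
    and P: "\<And>y. P *v y = (\<Sum>s\<in>A. (\<alpha> s * dot (w s) y) *s v s)"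
    and N: "\<And>y. N *v y = (\<Sum>s\<in>A. (\<beta> s * dot (w s) y) *s v s) + dot w0 y *s v0"
    and NN: "\<And>y. N *v (N *v y) = 0" and PN: "\<And>y. P *v (N *v y) = N *v y"
    and y: "dot w0 y = 0" "dot w0 (N *v y) = 0"
  shows "N *v y = 0"
proof -
  define q where "q = N *v y"
  note ind = spanning_family_independent [OF sp A]
  have "(\<Sum>s\<in>A. (\<beta> s * dot (w s) q) *s v s) = 0"
    using N [of q] NN [of y] y(2) by (simp add: q_def)
  then have 1: "\<beta> s * dot (w s) q = 0" if "s \<in> A" for s
    using ind [of "\<lambda>s. \<beta> s * dot (w s) q"] that by simp
  have "(\<Sum>s\<in>A. (\<beta> s * dot (w s) y) *s v s) = (\<Sum>s\<in>A. (\<alpha> s * dot (w s) q) *s v s)"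
    using N [of y] PN [of y] P [of q] y(1) by (simp add: q_def)
  then have "(\<Sum>s\<in>A. (\<beta> s * dot (w s) y - \<alpha> s * dot (w s) q) *s v s) = 0"
    by (simp add: vec.scale_left_diff_distrib sum_subtractf)
  then have 2: "\<beta> s * dot (w s) y - \<alpha> s * dot (w s) q = 0" if "s \<in> A" for s
    using ind [of "\<lambda>s. \<beta> s * dot (w s) y - \<alpha> s * dot (w s) q"] that by simp
  \<comment> \<open>If \<open>\<beta> s = 0\<close>, fact 2 gives this; otherwise fact 1 gives
    \<open>dot (w s) q = 0\<close>.\<close>
  have "\<alpha> s * dot (w s) q = 0" if "s \<in> A" for s
    using 1 [OF that] 2 [OF that] by auto
  then have "P *v q = 0" by (auto simp: P intro!: sum.neutral)
  then show ?thesis using PN [of y] by (simp add: q_def)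
qed

section \<open>Tensor decompositions and matrices of linear forms\<close>

lemma tensor_rank_sum_list_le: "tensor_rank (\<Sum>(u, v, w)\<leftarrow>ts. tensor3 u v w) \<le> length ts"
  unfolding tensor_rank_def
proof (rule Least_le, intro exI)
  show "(\<Sum>(u, v, w)\<leftarrow>ts. tensor3 u v w) = (\<Sum>s<length ts.
      tensor3 (fst (ts ! s)) (fst (snd (ts ! s))) (snd (snd (ts ! s))))"
    by (simp add: sum_list_sum_nth case_prod_unfold atLeast0LessThan)
qed

lemma tensor_rank_decomposition:
  fixes T :: "complex^'c::finite^'b::finite^'a::finite"
  obtains u v w where "T = (\<Sum>s<tensor_rank T. tensor3 (u s) (v s) (w s))"
  using LeastI_ex [OF tensor_rank_decomposition_exists [of T]]
  unfolding tensor_rank_def by blast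

text \<open>Contracting the first factor with the basis \<open>b\<close> dual to \<open>a\<close>
  isolates each slice. All slices are then combinations of the same matrices
  \<open>v s (w s)^T\<close>, and the choice of \<open>a\<close> only affects
  \<open>c\<close>.\<close>

lemma slices_of_decomposition:
  fixes a :: "'a::finite \<Rightarrow> complex^'a" and M :: "complex^'a \<Rightarrow> complex^'c::finite^'b::finite"
  assumes a: "is_basis a"
    and T: "tensor_of_forms a M = (\<Sum>s<r. tensor3 (u s) (v s) (w s))"
  obtains c where "\<And>i j k. M (axis i 1) $ j $ k = (\<Sum>s<r. c s $ i * v s $ j * w s $ k)"
proof -
  have ind: "vec.independent (range a)" and inj: "inj a" using a by (auto simp: is_basis_def)
  have "\<forall>i. \<exists>x. \<forall>i'. dot (a i') x = (if i' = i then 1 else 0)"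
  proof
    fix i
    show "\<exists>x. \<forall>i'. dot (a i') x = (if i' = i then 1 else 0)"
      using dual_vector [OF ind rangeI [of a i]] inj by (metis injD rangeI)
  qed
  then obtain b where b: "\<And>i i'. dot (a i') (b i) = (if i' = i then 1 else 0)" by metis
  show ?thesis
  proof (rule that [of "\<lambda>s. \<chi> i. dot (u s) (b i)"])
    fix i j k
    have entry: "(\<Sum>i'\<in>UNIV. a i' $ l * M (axis i' 1) $ j $ k) = (\<Sum>s<r. u s $ l * v s $ j * w s $ k)" for l
      using arg_cong [OF T, of "\<lambda>t. t $ l $ j $ k"]
      by (simp add: tensor_of_forms_def tensor_vec_mat_def tensor3_def)
    have "M (axis i 1) $ j $ k = (\<Sum>i'\<in>UNIV. dot (a i') (b i) * M (axis i' 1) $ j $ k)"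
      by (simp add: b if_distrib [of "\<lambda>z. z * _"] cong: if_cong)
    also have "\<dots> = (\<Sum>l\<in>UNIV. b i $ l * (\<Sum>i'\<in>UNIV. a i' $ l * M (axis i' 1) $ j $ k))"
      unfolding dot_def sum_distrib_left sum_distrib_right
      by (subst sum.swap) (simp add: mult_ac)
    also have "\<dots> = (\<Sum>s<r. dot (u s) (b i) * v s $ j * w s $ k)"
      unfolding entry dot_def sum_distrib_left sum_distrib_right
      by (subst sum.swap) (simp add: mult_ac)
    finally show "M (axis i 1) $ j $ k = (\<Sum>s<r. (\<chi> i. dot (u s) (b i)) $ i * v s $ j * w s $ k)"
      by simp
  qed
qed

lemma forms_of_slices:
  fixes M :: "complex^'a::finite \<Rightarrow> complex^'c::finite^'b::finite"
  assumes lin: "\<And>x j k. M x $ j $ k = (\<Sum>i\<in>UNIV. x $ i * M (axis i 1) $ j $ k)"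
    and c: "\<And>i j k. M (axis i 1) $ j $ k = (\<Sum>s<r. c s $ i * v s $ j * w s $ k)"
  shows "M x *v y = (\<Sum>s<r. (dot (c s) x * dot (w s) y) *s v s)"
  unfolding vec_eq_iff
proof
  fix j
  have entry: "M x $ j $ k = (\<Sum>s<r. dot (c s) x * v s $ j * w s $ k)" for k
    unfolding lin [of x] c dot_def sum_distrib_left sum_distrib_right
    by (subst sum.swap) (simp add: mult_ac)
  have "(M x *v y) $ j = (\<Sum>s<r. (dot (c s) x * dot (w s) y) * v s $ j)"
    unfolding matrix_vector_mult_def vec_lambda_beta entry dot_def [of "w _"]
      sum_distrib_left sum_distrib_right
    by (subst sum.swap) (simp add: mult_ac)
  then show "(M x *v y) $ j = (\<Sum>s<r. (dot (c s) x * dot (w s) y) *s v s) $ j" by simp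
qed

section \<open>The concrete matrices\<close>

lemma exhaust_5: "x = 1 \<or> x = 2 \<or> x = 3 \<or> x = 4 \<or> x = 5" for x :: 5
proof (induct x)
  case (of_int z)
  then have "z = 0 \<or> z = 1 \<or> z = 2 \<or> z = 3 \<or> z = 4" by fastforce
  then show ?case by auto
qed

lemma forall_5: "(\<forall>i::5. P i) \<longleftrightarrow> P 1 \<and> P 2 \<and> P 3 \<and> P 4 \<and> P 5"
  by (metis exhaust_5)

lemma UNIV_5: "UNIV = {1, 2, 3, 4, 5::5}"
  using exhaust_5 by auto

lemma sum_5: "sum f (UNIV::5 set) = f 1 + f 2 + f 3 + f 4 + f 5"
  unfolding UNIV_5 by (simp add: ac_simps)

lemmas form_matrix_simps = form_matrix_def block_N_def vector_5

lemma block_N_linear: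
  "block_N j x $ p $ q = (\<Sum>i\<in>UNIV. x $ i * block_N j (axis i 1) $ p $ q)"
proof -
  \<comment> \<open>Any other \<open>j\<close> gives the zero block, so linearity holds for every
    \<open>j\<close>.\<close>
  consider "j = 9" | "j = 19" | "j = 20" | "j = 21" | "j = 22" | "j = 23"
    | "j \<notin> {9, 19, 20, 21, 22, 23}" by blast
  then have "\<forall>p q. block_N j x $ p $ q = (\<Sum>i\<in>UNIV. x $ i * block_N j (axis i 1) $ p $ q)"
    unfolding forall_2 forall_3 sum_5 by cases (simp_all add: block_N_def axis_def)
  then show ?thesis by blast
qed

lemma form_matrix_linear:
  "form_matrix j x $ p $ q = (\<Sum>i\<in>UNIV. x $ i * form_matrix j (axis i 1) $ p $ q)"
proof -
  have "\<forall>p q. form_matrix j x $ p $ q = (\<Sum>i\<in>UNIV. x $ i * form_matrix j (axis i 1) $ p $ q)"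
    unfolding forall_5 sum_5
    by (simp add: form_matrix_def vector_5 block_N_linear [of j x, unfolded sum_5]) (simp add: axis_def)
  then show ?thesis by blast
qed

lemma form_matrix_mult_entries:
  "(form_matrix j x *v y) $ 1 = x $ 1 * y $ 1"
  "(form_matrix j x *v y) $ 2 = x $ 1 * y $ 2"
  "(form_matrix j x *v y) $ 3 = x $ 1 * y $ 3"
  "(form_matrix j x *v y) $ 4 = block_N j x $ 1 $ 1 * y $ 1 + block_N j x $ 1 $ 2 * y $ 2
     + block_N j x $ 1 $ 3 * y $ 3 + x $ 1 * y $ 4"
  "(form_matrix j x *v y) $ 5 = block_N j x $ 2 $ 1 * y $ 1 + block_N j x $ 2 $ 2 * y $ 2
     + block_N j x $ 2 $ 3 * y $ 3 + x $ 1 * y $ 5"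
  by (simp_all add: matrix_vector_mult_def sum_5 form_matrix_def vector_5)

text \<open>The matrix is \<open>I + B\<close> with \<open>B\<close> the block part and
  \<open>B^2 = 0\<close>, so \<open>(I - B) y\<close> is a preimage of \<open>y\<close>.\<close>

lemma form_matrix_surj:
  assumes "x $ 1 = 1"
  shows "surj ((*v) (form_matrix j x))"
proof (rule surjI)
  fix y :: "complex^5"
  let ?z = "vector [y $ 1, y $ 2, y $ 3,
    y $ 4 - (block_N j x $ 1 $ 1 * y $ 1 + block_N j x $ 1 $ 2 * y $ 2 + block_N j x $ 1 $ 3 * y $ 3),
    y $ 5 - (block_N j x $ 2 $ 1 * y $ 1 + block_N j x $ 2 $ 2 * y $ 2 + block_N j x $ 2 $ 3 * y $ 3)]"
  show "form_matrix j x *v ?z = y"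
    by (simp add: vec_eq_iff forall_5 form_matrix_mult_entries vector_5 assms)
qed

text \<open>Each of the five variables is itself an entry of the matrix.\<close>

lemma form_matrix_eq_0:
  assumes "j \<in> {9, 19, 20, 21, 22, 23}" "form_matrix j x = 0"
  shows "x = 0"
  using assms by (auto simp: vec_eq_iff forall_5 form_matrix_simps)

section \<open>Lower bounds\<close>

text \<open>The substitution method on the hyperplane where the first coordinate vanishes, that is,
  with \<open>e = axis 1 1\<close>; it serves both lower bounds.\<close>

lemma tensor_T_decomposition:
  fixes a :: "5 \<Rightarrow> complex^5" and r :: nat
  assumes a: "is_basis a" and j: "j \<in> {9, 19, 20, 21, 22, 23}"
    and T: "tensor_T a j = (\<Sum>s<r. tensor3 (u s) (v s) (w s))"
  obtains c S x0 d where
    "\<And>x y. form_matrix j x *v y = (\<Sum>s<r. (dot (c s) x * dot (w s) y) *s v s)"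
    "S \<subseteq> {..<r}" "card S = 4"
    "x0 $ 1 = 1" "\<And>s. s \<in> S \<Longrightarrow> dot (c s) x0 = 0"
    "\<And>s. s \<in> S \<Longrightarrow> d s $ 1 = 0"
    "\<And>s t. s \<in> S \<Longrightarrow> t \<in> S \<Longrightarrow> dot (c t) (d s) = (if t = s then 1 else 0)"
    "\<And>x. x $ 1 = 0 \<Longrightarrow> x = (\<Sum>s\<in>S. dot (c s) x *s d s)"
    "vec.span (v ` ({..<r} - S)) = UNIV"
proof -
  obtain c where c: "\<And>i p q. form_matrix j (axis i 1) $ p $ q = (\<Sum>s<r. c s $ i * v s $ p * w s $ q)"
    using slices_of_decomposition [OF a T [unfolded tensor_T_def]] by blast
  have M: "form_matrix j x *v y = (\<Sum>s<r. (dot (c s) x * dot (w s) y) *s v s)" for x y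
    by (rule forms_of_slices [OF form_matrix_linear c])
  have inj: "x = 0" if "dot (axis 1 1) x = 0" "form_matrix j x = 0" for x
    using form_matrix_eq_0 [OF j] that by blast
  have surj: "surj ((*v) (form_matrix j x))" if "dot (axis 1 1) x = 1" for x
    using form_matrix_surj that by (simp add: dot_axis)
  have e: "axis 1 1 \<noteq> (0 :: complex^5)" by simp
  show ?thesis
  proof (rule substitution_method [where M = "form_matrix j" and c = c and w = w and v = v and r = r
        and e = "axis 1 1", OF M e inj surj], unfold dot_axis)
    fix S x0 d
    assume S: "S \<subseteq> {..<r}" "card S = CARD(5) - 1"
      "x0 $ 1 = 1" "\<And>s. s \<in> S \<Longrightarrow> dot (c s) x0 = 0"
      "\<And>s. s \<in> S \<Longrightarrow> d s $ 1 = 0"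
      "\<And>s t. s \<in> S \<Longrightarrow> t \<in> S \<Longrightarrow> dot (c t) (d s) = (if t = s then 1 else 0)"
      "\<And>x. x $ 1 = 0 \<Longrightarrow> x = (\<Sum>s\<in>S. dot (c s) x *s d s)"
      "vec.span (v ` ({..<r} - S)) = UNIV"
    have "card S = 4" using S(2) by simp
    then show thesis using S by (intro that [of c S x0 d] M) assumption+
  qed
qed

lemma tensor_rank_T_ge_9:
  fixes a :: "5 \<Rightarrow> complex^5"
  assumes a: "is_basis a" and j: "j \<in> {9, 19, 20, 21, 22, 23}"
  shows "tensor_rank (tensor_T a j) \<ge> 9"
proof -
  let ?r = "tensor_rank (tensor_T a j)"
  obtain u v w where T: "tensor_T a j = (\<Sum>s<?r. tensor3 (u s) (v s) (w s))"
    by (rule tensor_rank_decomposition)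
  obtain S where S: "S \<subseteq> {..<?r}" "card S = 4" "vec.span (v ` ({..<?r} - S)) = UNIV"
    by (rule tensor_T_decomposition [OF a j T]) blast
  have "CARD(5) \<le> card ({..<?r} - S)" by (rule UNIV_spanned_card_le) (use S in auto)
  then show ?thesis using S card_Diff_subset [of S "{..<?r}"] finite_subset [OF S(1)] by simp
qed

lemma tensor_rank_T_21_neq_9:
  fixes a :: "5 \<Rightarrow> complex^5"
  assumes a: "is_basis a"
  shows "tensor_rank (tensor_T a 21) \<noteq> 9"
proof
  assume r9: "tensor_rank (tensor_T a 21) = 9"
  obtain u v w where T: "tensor_T a 21 = (\<Sum>s<9::nat. tensor3 (u s) (v s) (w s))"
    by (rule tensor_rank_decomposition [of "tensor_T a 21", unfolded r9])
  obtain c S x0 d where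
    M: "\<And>x y. form_matrix 21 x *v y = (\<Sum>s<9. (dot (c s) x * dot (w s) y) *s v s)" and
    S: "S \<subseteq> {..<9}" "card S = 4" and
    x0: "x0 $ 1 = 1" "\<And>s. s \<in> S \<Longrightarrow> dot (c s) x0 = 0" and
    d: "\<And>s. s \<in> S \<Longrightarrow> d s $ 1 = 0"
      "\<And>s t. s \<in> S \<Longrightarrow> t \<in> S \<Longrightarrow> dot (c t) (d s) = (if t = s then 1 else 0)"
      "\<And>x. x $ 1 = 0 \<Longrightarrow> x = (\<Sum>s\<in>S. dot (c s) x *s d s)" and
    sp: "vec.span (v ` ({..<9} - S)) = UNIV"
    by (rule tensor_T_decomposition [OF a _ T]) blast+
  let ?A = "{..<9} - S"
  have finS: "finite S" using S(1) finite_subset by blast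
  have A: "finite ?A" "card ?A = CARD(5)" using S finS by (simp_all add: card_Diff_subset)
  \<comment> \<open>The \<open>d s\<close> span the hyperplane, which contains
    \<open>axis 5 1\<close>.\<close>
  have "\<exists>s\<in>S. d s $ 5 \<noteq> 0"
  proof (rule ccontr)
    assume "\<not> ?thesis"
    moreover have "axis 5 1 = (\<Sum>s\<in>S. dot (c s) (axis 5 1) *s d s)"
      by (rule d(3)) (simp add: axis_def)
    then have "axis 5 1 $ 5 = (\<Sum>s\<in>S. dot (c s) (axis 5 1) *s d s) $ 5" by simp
    ultimately show False by simp
  qed
  then obtain s0 where s0: "s0 \<in> S" "d s0 $ 5 \<noteq> 0" by blast
  define x where "x = d s0"
  have x1: "x $ 1 = 0" and x5: "x $ 5 \<noteq> 0" using d(1) s0 by (auto simp: x_def)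
  define P where "P = form_matrix 21 x0"
  define N where "N = form_matrix 21 x"
  note entries = form_matrix_mult_entries [of 21]
  have N_entries: "(N *v y) $ 1 = 0" "(N *v y) $ 2 = 0" "(N *v y) $ 3 = 0"
    "(N *v y) $ 4 = x $ 2 * y $ 1 + x $ 4 * y $ 2 + x $ 5 * y $ 3"
    "(N *v y) $ 5 = x $ 3 * y $ 1 + x $ 5 * y $ 2" for y
    by (simp_all add: N_def entries x1 block_N_def)
  \<comment> \<open>The range of \<open>N\<close> lies in the last two coordinates; \<open>N\<close>
    kills these and \<open>P\<close> fixes them.\<close>
  have NN: "N *v (N *v y) = 0" for y
    by (simp add: vec_eq_iff forall_5 N_entries)
  have PN: "P *v (N *v y) = N *v y" for y
    by (simp add: vec_eq_iff forall_5 N_entries P_def entries x0(1))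
  have P: "P *v y = (\<Sum>s\<in>?A. (dot (c s) x0 * dot (w s) y) *s v s)" for y
    unfolding P_def M by (rule sum.mono_neutral_right) (auto simp: x0(2))
  \<comment> \<open>By duality the only summand from \<open>S\<close> that survives at
    \<open>d s0\<close> is the one at \<open>s0\<close>, with coefficient form equal to 1.\<close>
  have N: "N *v y = (\<Sum>s\<in>?A. (dot (c s) x * dot (w s) y) *s v s) + dot (w s0) y *s v s0" for y
  proof -
    have "N *v y = (\<Sum>s\<in>?A. (dot (c s) x * dot (w s) y) *s v s)
        + (\<Sum>s\<in>S. (dot (c s) x * dot (w s) y) *s v s)"
      unfolding N_def M by (rule sum.subset_diff) (use S in auto)
    also have "(\<Sum>s\<in>S. (dot (c s) x * dot (w s) y) *s v s) = (\<Sum>s\<in>{s0}. dot (w s) y *s v s)"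
      by (rule sum.mono_neutral_cong_right) (use finS s0(1) d(2) in \<open>auto simp: x_def\<close>)
    finally show ?thesis by simp
  qed
  have ker: "N *v y = 0" if "dot (w s0) y = 0" "dot (w s0) (N *v y) = 0" for y
    by (rule minimal_decomposition_kernel [OF sp A P N NN PN that])
  define \<omega> where "\<omega> = w s0"
  note dot_\<omega> = dot_def [of \<omega>, unfolded sum_5]
  \<comment> \<open>The second condition says that \<open>N y\<close> is annihilated by
    \<open>\<omega>\<close>. The cases below construct a \<open>y\<close> with
    \<open>y $ 1 = 0\<close> that violates this conclusion.\<close>
  have no_y: "y $ 1 \<noteq> 0 \<or> y $ 2 = 0 \<and> y $ 3 = 0"
    if "dot \<omega> y = 0" "\<omega> $ 4 * (N *v y) $ 4 + \<omega> $ 5 * (N *v y) $ 5 = 0" for y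
  proof -
    have "N *v y = 0"
      using that ker [of y] by (simp add: \<omega>_def [symmetric] dot_\<omega> N_entries)
    then have "(N *v y) $ 4 = 0" "(N *v y) $ 5 = 0" by simp_all
    then show ?thesis using x5 by (auto simp: N_entries)
  qed
  show False
  proof (cases "\<omega> $ 4 = 0 \<and> \<omega> $ 5 = 0")
    \<comment> \<open>Now the condition on \<open>N y\<close> is void, and a nonzero vector in
      coordinates 2 and 3 annihilated by \<open>\<omega>\<close> suffices.\<close>
    case True
    show False
    proof (cases "\<omega> $ 2 = 0")
      case True
      then show False using no_y [of "vector [0, 1, 0, 0, 0]"] \<open>\<omega> $ 4 = 0 \<and> \<omega> $ 5 = 0\<close>
        by (simp add: dot_\<omega> vector_5)
    next
      case False
      then show False using no_y [of "vector [0, - \<omega> $ 3, \<omega> $ 2, 0, 0]"] \<open>\<omega> $ 4 = 0 \<and> \<omega> $ 5 = 0\<close>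
        by (simp add: dot_\<omega> vector_5)
    qed
  next
    case False
    \<comment> \<open>\<open>y2\<close> and \<open>y3\<close> make \<open>N y\<close> orthogonal to \<open>\<omega>\<close>; the last two entries make \<open>y\<close> so.\<close>
    define y2 where "y2 = - \<omega> $ 4 / x $ 5"
    define y3 where "y3 = (\<omega> $ 5 - x $ 4 * y2) / x $ 5"
    define t where "t = \<omega> $ 2 * y2 + \<omega> $ 3 * y3"
    define y :: "complex^5" where "y = (if \<omega> $ 4 \<noteq> 0
      then vector [0, y2, y3, - t / \<omega> $ 4, 0] else vector [0, y2, y3, 0, - t / \<omega> $ 5])"
    have y: "y $ 1 = 0" "y $ 2 = y2" "y $ 3 = y3" by (simp_all add: y_def vector_5)
    have "dot \<omega> y = 0"
      using False by (auto simp: dot_\<omega> y_def vector_5 t_def)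
    moreover have "(N *v y) $ 4 = \<omega> $ 5" "(N *v y) $ 5 = - \<omega> $ 4"
      using x5 by (simp_all add: N_entries y y3_def y2_def)
    ultimately have "y2 = 0" "y3 = 0" using no_y [of y] by (simp_all add: y)
    with False x5 show False by (auto simp: y2_def y3_def)
  qed
qed

section \<open>Upper bounds\<close>

text \<open>Only the block remains to be decomposed: a triple \<open>(c, v, w)\<close> stands for
  the matrix \<open>v w^T\<close> multiplied by the linear form \<open>c\<close>.\<close>

lemma tensor_rank_T_le:
  fixes a :: "5 \<Rightarrow> complex^5"
  assumes ts: "\<And>x p q. form_matrix j x $ p $ q = x $ 1 * (if p = q then 1 else 0)
    + (\<Sum>(c, v, w)\<leftarrow>ts. dot c x * v $ p * w $ q)"
  shows "tensor_rank (tensor_T a j) \<le> 5 + length ts"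
proof -
  \<comment> \<open>The five diagonal matrix units, each with coefficient
    \<open>x $ 1\<close>.\<close>
  define D :: "((complex^5) \<times> (complex^5) \<times> (complex^5)) list"
    where "D = map (\<lambda>i. (axis 1 1, axis i 1, axis i 1)) [1, 2, 3, 4, 5]"
  \<comment> \<open>\<open>A\<close> turns the coefficients of a form into the first tensor factor,
    expressed through \<open>a\<close>.\<close>
  define A where "A c = (\<Sum>i\<in>UNIV. c $ i *s a i)" for c
  have D: "(\<Sum>(c, v, w)\<leftarrow>D. c $ i * v $ p * w $ q) = axis i 1 $ 1 * (if p = q then 1 else 0)"
    for i :: 5 and p q
    using exhaust_5 [of p] exhaust_5 [of q] by (elim disjE) (simp_all add: D_def axis_def)
  have form: "form_matrix j (axis i 1) $ p $ q = (\<Sum>(c, v, w)\<leftarrow>D @ ts. c $ i * v $ p * w $ q)" for i p q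
    unfolding ts dot_axis by (simp add: D)
  have *: "(\<Sum>i\<in>UNIV. a i $ l * (\<Sum>(c, v, w)\<leftarrow>xs. c $ i * v $ p * w $ q))
    = (\<Sum>(u, v, w)\<leftarrow>map (\<lambda>(c, v, w). (A c, v, w)) xs. tensor3 u v w) $ l $ p $ q"
    for l p q and xs :: "((complex^5) \<times> (complex^5) \<times> (complex^5)) list"
  proof (induction xs)
    case (Cons x xs)
    obtain c v w where x: "x = (c, v, w)" by (cases x)
    have "(\<Sum>i\<in>UNIV. a i $ l * (c $ i * v $ p * w $ q)) = A c $ l * v $ p * w $ q"
      by (simp add: A_def sum_distrib_left sum_distrib_right mult_ac)
    then show ?case using Cons
      by (simp add: x distrib_left sum.distrib tensor3_def)
  qed simp
  have "tensor_T a j = (\<Sum>(u, v, w)\<leftarrow>map (\<lambda>(c, v, w). (A c, v, w)) (D @ ts). tensor3 u v w)"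
    unfolding vec_eq_iff * [symmetric] form [symmetric]
    by (simp add: tensor_T_def tensor_of_forms_def tensor_vec_mat_def)
  then show ?thesis
    using tensor_rank_sum_list_le [of "map (\<lambda>(c, v, w). (A c, v, w)) (D @ ts)"] by (simp add: D_def)
qed

lemma tensor_rank_T_9_le: "tensor_rank (tensor_T a 9) \<le> 9"
proof -
  \<comment> \<open>One matrix unit per nonzero entry, as also for blocks 20 and 22; the block rows
    are 4 and 5.\<close>
  let ?ts = "[(axis 2 1, axis 4 1, axis 1 1),
      (axis 3 1, axis 4 1, axis 2 1),
      (axis 4 1, axis 5 1, axis 1 1),
      (axis 5 1, axis 5 1, axis 2 1)] ::
    ((complex^5) \<times> (complex^5) \<times> (complex^5)) list"
  have "\<forall>p q. form_matrix 9 x $ p $ q = x $ 1 * (if p = q then 1 else 0)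
      + (\<Sum>(c, v, w)\<leftarrow>?ts. dot c x * v $ p * w $ q)" for x
    unfolding forall_5
    by (simp add: form_matrix_simps dot_simps dot_axis) (simp add: axis_def field_simps)
  then have "tensor_rank (tensor_T a 9) \<le> 5 + length ?ts"
    by (intro tensor_rank_T_le) blast
  then show ?thesis by simp
qed

lemma tensor_rank_T_19_le: "tensor_rank (tensor_T a 19) \<le> 9"
proof -
  \<comment> \<open>The first two columns form a symmetric matrix, spanned by two diagonal units and
    the all-ones matrix; the third column is a single unit.\<close>
  let ?ts = "[(axis 2 1 - axis 3 1, axis 4 1, axis 1 1),
      (axis 3 1, axis 4 1 + axis 5 1, axis 1 1 + axis 2 1),
      (axis 4 1 - axis 3 1, axis 5 1, axis 2 1),
      (axis 5 1, axis 4 1, axis 3 1)] ::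
    ((complex^5) \<times> (complex^5) \<times> (complex^5)) list"
  have "\<forall>p q. form_matrix 19 x $ p $ q = x $ 1 * (if p = q then 1 else 0)
      + (\<Sum>(c, v, w)\<leftarrow>?ts. dot c x * v $ p * w $ q)" for x
    unfolding forall_5
    by (simp add: form_matrix_simps dot_simps dot_axis) (simp add: axis_def field_simps)
  then have "tensor_rank (tensor_T a 19) \<le> 5 + length ?ts"
    by (intro tensor_rank_T_le) blast
  then show ?thesis by simp
qed

lemma tensor_rank_T_20_le: "tensor_rank (tensor_T a 20) \<le> 9"
proof -
  let ?ts = "[(axis 2 1, axis 4 1, axis 1 1),
      (axis 4 1, axis 4 1, axis 2 1),
      (axis 5 1, axis 4 1, axis 3 1),
      (axis 3 1, axis 5 1, axis 1 1)] ::
    ((complex^5) \<times> (complex^5) \<times> (complex^5)) list"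
  have "\<forall>p q. form_matrix 20 x $ p $ q = x $ 1 * (if p = q then 1 else 0)
      + (\<Sum>(c, v, w)\<leftarrow>?ts. dot c x * v $ p * w $ q)" for x
    unfolding forall_5
    by (simp add: form_matrix_simps dot_simps dot_axis) (simp add: axis_def field_simps)
  then have "tensor_rank (tensor_T a 20) \<le> 5 + length ?ts"
    by (intro tensor_rank_T_le) blast
  then show ?thesis by simp
qed

lemma tensor_rank_T_21_le: "tensor_rank (tensor_T a 21) \<le> 10"
proof -
  \<comment> \<open>Columns 2 and 3 form a symmetric matrix treated with the all-ones matrix; the
    last triple cancels the unwanted corner entry.\<close>
  let ?ts = "[(axis 2 1, axis 4 1, axis 1 1),
      (axis 3 1, axis 5 1, axis 1 1),
      (axis 4 1 - axis 5 1, axis 4 1, axis 2 1),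
      (axis 5 1, axis 4 1 + axis 5 1, axis 2 1 + axis 3 1),
      (axis 5 1, - axis 5 1, axis 3 1)] ::
    ((complex^5) \<times> (complex^5) \<times> (complex^5)) list"
  have "\<forall>p q. form_matrix 21 x $ p $ q = x $ 1 * (if p = q then 1 else 0)
      + (\<Sum>(c, v, w)\<leftarrow>?ts. dot c x * v $ p * w $ q)" for x
    unfolding forall_5
    by (simp add: form_matrix_simps dot_simps dot_axis) (simp add: axis_def field_simps)
  then have "tensor_rank (tensor_T a 21) \<le> 5 + length ?ts"
    by (intro tensor_rank_T_le) blast
  then show ?thesis by simp
qed

lemma tensor_rank_T_22_le: "tensor_rank (tensor_T a 22) \<le> 9"
proof -
  let ?ts = "[(axis 2 1, axis 4 1, axis 1 1),
      (axis 4 1, axis 4 1, axis 2 1),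
      (axis 3 1, axis 5 1, axis 1 1),
      (axis 5 1, axis 5 1, axis 3 1)] ::
    ((complex^5) \<times> (complex^5) \<times> (complex^5)) list"
  have "\<forall>p q. form_matrix 22 x $ p $ q = x $ 1 * (if p = q then 1 else 0)
      + (\<Sum>(c, v, w)\<leftarrow>?ts. dot c x * v $ p * w $ q)" for x
    unfolding forall_5
    by (simp add: form_matrix_simps dot_simps dot_axis) (simp add: axis_def field_simps)
  then have "tensor_rank (tensor_T a 22) \<le> 5 + length ?ts"
    by (intro tensor_rank_T_le) blast
  then show ?thesis by simp
qed

lemma tensor_rank_T_23_le: "tensor_rank (tensor_T a 23) \<le> 9"
proof -
  \<comment> \<open>The block is a Hankel matrix, hence a combination of the matrices \<open>(1, t)\<^sup>T (1, t, t\<^sup>2)\<close>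
    for \<open>t = 0, 1, -1, \<infinity>\<close>.\<close>
  let ?ts = "[(axis 2 1 - axis 4 1, axis 4 1, axis 1 1),
      ((1/2) *s (axis 3 1 + axis 4 1), axis 4 1 + axis 5 1, axis 1 1 + axis 2 1 + axis 3 1),
      ((1/2) *s (axis 4 1 - axis 3 1), axis 4 1 - axis 5 1, axis 1 1 - axis 2 1 + axis 3 1),
      (axis 5 1 - axis 3 1, axis 5 1, axis 3 1)] ::
    ((complex^5) \<times> (complex^5) \<times> (complex^5)) list"
  have "\<forall>p q. form_matrix 23 x $ p $ q = x $ 1 * (if p = q then 1 else 0)
      + (\<Sum>(c, v, w)\<leftarrow>?ts. dot c x * v $ p * w $ q)" for x
    unfolding forall_5
    by (simp add: form_matrix_simps dot_simps dot_axis) (simp add: axis_def field_simps)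
  then have "tensor_rank (tensor_T a 23) \<le> 5 + length ?ts"
    by (intro tensor_rank_T_le) blast
  then show ?thesis by simp
qed

theorem proposition6p7:
  fixes a :: "5 \<Rightarrow> complex^5"
  assumes "is_basis a"
  shows "tensor_rank (tensor_T a 21) = 10 \<and> (\<forall>j\<in>{9, 19, 20, 22, 23}. tensor_rank (tensor_T a j) = 9)"
proof (intro conjI ballI)
  show "tensor_rank (tensor_T a 21) = 10"
    using tensor_rank_T_ge_9 [OF assms, of 21] tensor_rank_T_21_neq_9 [OF assms]
      tensor_rank_T_21_le [of a] by simp
next
  fix j :: nat
  assume j: "j \<in> {9, 19, 20, 22, 23}"
  then have "tensor_rank (tensor_T a j) \<le> 9"
    using tensor_rank_T_9_le tensor_rank_T_19_le tensor_rank_T_20_le tensor_rank_T_22_le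
      tensor_rank_T_23_le by blast
  with tensor_rank_T_ge_9 [OF assms, of j] j show "tensor_rank (tensor_T a j) = 9" by auto
qed

end
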